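(* Let $S=\{s_1,\dots,s_t\}$ with $t\ge 3$, $1<s_1<s_2<\dots<s_t$ integers and $\gcd(s_1,\dots,s_t)=1$, and let $\mathbb{S}=\langle S\rangle$ with Frobenius number $F(\mathbb{S})$. If there exists $k\in\mathbb{S}$ with $\mathrm{MinCost}_S(k)<\mathrm{GreedyCost}_S(k)$, then the smallest such $k$ satisfies $$s_3+s_1+2\le k\le F(\mathbb{S})+s_t+s_{t-1}.$$ Moreover, both bounds are tight: there exist such sets $S$ for which the smallest such $k$ equals $s_3+s_1+2$, and there exist such sets $S$ for which the smallest such $k$ equals $F(\mathbb{S})+s_t+s_{t-1}$.
   Context: $\langle S\rangle=\{\sum_i a_i s_i : a_i\in\mathbb{N}_0\}$ is the numerical semigroup generated by $S$; $F(\mathbb{S})$ is the largest integer not in $\mathbb{S}$. A representation of $k\in\langle S\rangle$ is a vector $(a_1,\dots,a_t)\in\mathbb{N}_0^t$ with $\sum_i a_i s_i=k$; its cost is $\sum_i a_i$. $\mathrm{MinCost}_S(k)$ is the minimum cost over all representations of $k$. The (generalized) greedy representation of $k\in\langle S\rangle$, $k>0$, is computed as follows: set $r:=k$; for $i=t,t-1,\dots,1$ let $a_i$ be the largest integer $q\ge 0$ such that $r-q s_i\in\langle S\rangle$, and replace $r$ by $r-a_i s_i$ (at the end $r=0$). $\mathrm{GreedyCost}_S(k)=\sum_i a_i$ for this vector. *)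

theory Defs
  imports Main
begin

text \<open>
  A generating set \<open>s\<^sub>1 < \<dots> < s\<^sub>t\<close> is a sequence \<open>s :: nat \<Rightarrow> nat\<close> together with its length \<open>t\<close>;
  vectors of length \<open>t\<close> are sequences too. Only the entries with index in \<open>{1..t}\<close> matter.
\<close>

definition generators :: "(nat \<Rightarrow> nat) \<Rightarrow> nat \<Rightarrow> bool" where
  "generators s t \<longleftrightarrow>
     3 \<le> t \<and> 1 < s 1 \<and> strict_mono_on {1..t} s \<and> Gcd (s ` {1..t}) = 1"

definition representation :: "(nat \<Rightarrow> nat) \<Rightarrow> nat \<Rightarrow> nat \<Rightarrow> (nat \<Rightarrow> nat) \<Rightarrow> bool" where
  "representation s t k a \<longleftrightarrow> (\<Sum>i = 1..t. a i * s i) = k"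

definition cost :: "nat \<Rightarrow> (nat \<Rightarrow> nat) \<Rightarrow> nat" where
  "cost t a = (\<Sum>i = 1..t. a i)"

definition semigroup_gen :: "(nat \<Rightarrow> nat) \<Rightarrow> nat \<Rightarrow> nat set" where
  "semigroup_gen s t = {\<Sum>i = 1..t. a i * s i | a. True}"

text \<open>
  The maximum is taken over all integers. It exists whenever the complement of \<open>G\<close> in the
  naturals is finite, in particular for \<open>semigroup_gen s t\<close> with \<open>generators s t\<close>.
\<close>

definition frobenius :: "nat set \<Rightarrow> int" where
  "frobenius G = (GREATEST z. z \<notin> int ` G)"

definition min_cost :: "(nat \<Rightarrow> nat) \<Rightarrow> nat \<Rightarrow> nat \<Rightarrow> nat" where
  "min_cost s t k = (LEAST c. \<exists>a. representation s t k a \<and> cost t a = c)"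

text \<open>
  \<open>greedy_from s G i r\<close> runs the greedy procedure for the indices \<open>i, i - 1, \<dots>, 1\<close> on the
  remainder \<open>r\<close>. The constraint \<open>q * s i \<le> r\<close> rules out truncated subtraction; since \<open>G\<close>
  contains no negative integers, it is implied by \<open>r - q * s i \<in> G\<close> over the integers.
\<close>

primrec greedy_from :: "(nat \<Rightarrow> nat) \<Rightarrow> nat set \<Rightarrow> nat \<Rightarrow> nat \<Rightarrow> nat \<Rightarrow> nat" where
  "greedy_from s G 0 r = (\<lambda>_. 0)"
| "greedy_from s G (Suc i) r =
     (let q = (GREATEST q. q * s (Suc i) \<le> r \<and> r - q * s (Suc i) \<in> G)
      in (greedy_from s G i (r - q * s (Suc i)))(Suc i := q))"

definition greedy_rep :: "(nat \<Rightarrow> nat) \<Rightarrow> nat \<Rightarrow> nat \<Rightarrow> nat \<Rightarrow> nat" where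
  "greedy_rep s t k = greedy_from s (semigroup_gen s t) t k"

definition greedy_cost :: "(nat \<Rightarrow> nat) \<Rightarrow> nat \<Rightarrow> nat \<Rightarrow> nat" where
  "greedy_cost s t k = cost t (greedy_rep s t k)"

text \<open>
  The greedy representation is only of interest for \<open>k > 0\<close>; including \<open>0\<close> is harmless, as
  both costs of \<open>0\<close> are \<open>0\<close> when the generators are positive.
\<close>

definition counterexamples :: "(nat \<Rightarrow> nat) \<Rightarrow> nat \<Rightarrow> nat set" where
  "counterexamples s t = {k \<in> semigroup_gen s t. min_cost s t k < greedy_cost s t k}"

end

theory Submission
  imports Defs
begin

text \<open>
  The greedy representation of \<open>k\<close> takes one copy of \<open>s\<^sub>j\<close>, for the largest \<open>j\<close> with
  \<open>k - s\<^sub>j\<close> in the semigroup, and continues with \<open>k - s\<^sub>j\<close>. If \<open>k\<close> is the least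
  counterexample, then no optimal representation contains \<open>s\<^sub>j\<close>, as otherwise \<open>k - s\<^sub>j\<close> would
  be a smaller counterexample; nor does it contain \<open>s\<^sub>i\<close> with \<open>i > j\<close>. For \<open>j \<le> 2\<close>
  this leaves only \<open>s\<^sub>1\<close>, which cannot be cheaper than any other representation. So \<open>j \<ge> 3\<close>, and
  since the greedy cost is at least 3, \<open>k \<ge> s\<^sub>3 + 2 s\<^sub>1\<close>. If \<open>k > F + s\<^sub>t + s\<^sub>t\<^sub>-\<^sub>1\<close>,
  then \<open>j = t\<close>, and for any \<open>s\<^sub>i\<close> in an optimal representation \<open>k - s\<^sub>i - s\<^sub>t\<close> is still in
  the semigroup, so \<open>s\<^sub>t\<close> can be exchanged into an optimal representation of \<open>k - s\<^sub>i\<close>.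
  The bounds are attained by \<open>{2, 5, 6}\<close> with \<open>k = 10\<close> and by \<open>{2, 5, 7}\<close> with \<open>k = 15\<close>.
\<close>

section \<open>Representations, costs and closure of the semigroup\<close>

text \<open>Stated for arbitrary weights \<open>w\<close>, so that \<open>w = s\<close> tracks the
  represented value and constant weight 1 tracks the cost.\<close>

lemma sum_increment:
  fixes a w :: "nat \<Rightarrow> nat"
  assumes "finite A" "i \<in> A"
  shows "(\<Sum>j \<in> A. (a(i := Suc (a i))) j * w j) = (\<Sum>j \<in> A. a j * w j) + w i"
proof -
  have "(a(i := Suc (a i))) j * w j = a j * w j + (if j = i then w j else 0)" for j by simp
  then have "(\<Sum>j \<in> A. (a(i := Suc (a i))) j * w j)
      = (\<Sum>j \<in> A. a j * w j + (if j = i then w j else 0))"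
    by presburger
  then show ?thesis using assms by (simp add: sum.distrib)
qed

lemma representation_increment:
  assumes "representation s t k a" "i \<in> {1..t}"
  shows "representation s t (k + s i) (a(i := Suc (a i)))"
  using assms sum_increment[OF _ assms(2), of a s] unfolding representation_def by simp

lemma cost_increment:
  assumes "i \<in> {1..t}"
  shows "cost t (a(i := Suc (a i))) = Suc (cost t a)"
  using sum_increment[OF _ assms, of a "\<lambda>_. 1"] unfolding cost_def by simp

lemma representation_decrement:
  assumes "representation s t k a" "i \<in> {1..t}" "0 < a i"
  obtains x b where "k = x + s i" "representation s t x b" "cost t a = Suc (cost t b)"
proof -
  define b where "b = a(i := a i - 1)"
  have a: "a = b(i := Suc (b i))" using assms(3) by (auto simp: b_def)
  have "representation s t (\<Sum>i = 1..t. b i * s i) b" by (simp add: representation_def)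
  from representation_increment[OF this assms(2)] show thesis
    using that[of "\<Sum>i = 1..t. b i * s i" b] assms(1,2) cost_increment[of i t b]
    by (simp add: representation_def flip: a)
qed

lemma representation_support:
  assumes "representation s t k a" "0 < k"
  obtains i where "i \<in> {1..t}" "0 < a i"
proof -
  have "(\<Sum>i = 1..t. a i * s i) \<noteq> 0" using assms by (simp add: representation_def)
  then obtain i where "i \<in> {1..t}" "a i * s i \<noteq> 0" by (rule sum.not_neutral_contains_not_neutral)
  then show thesis using that by simp
qed

lemma semigroup_gen_iff: "k \<in> semigroup_gen s t \<longleftrightarrow> (\<exists>a. representation s t k a)"
  unfolding semigroup_gen_def representation_def by auto

lemma representation_imp_mem: "representation s t k a \<Longrightarrow> k \<in> semigroup_gen s t"
  by (auto simp: semigroup_gen_iff)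

lemma semigroup_gen_0 [simp]: "0 \<in> semigroup_gen s t"
  unfolding semigroup_gen_iff representation_def by (rule exI[of _ "\<lambda>_. 0"]) simp

lemma semigroup_gen_add:
  assumes "x \<in> semigroup_gen s t" "y \<in> semigroup_gen s t"
  shows "x + y \<in> semigroup_gen s t"
proof -
  obtain a b where "representation s t x a" "representation s t y b"
    using assms by (auto simp: semigroup_gen_iff)
  then have "representation s t (x + y) (\<lambda>i. a i + b i)"
    by (simp add: representation_def sum.distrib distrib_right)
  then show ?thesis by (rule representation_imp_mem)
qed

lemma semigroup_gen_mult: "x \<in> semigroup_gen s t \<Longrightarrow> n * x \<in> semigroup_gen s t"
  by (induction n) (auto intro: semigroup_gen_add)

lemma semigroup_gen_generator:
  assumes "i \<in> {1..t}"
  shows "s i \<in> semigroup_gen s t"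
proof -
  have "representation s t 0 (\<lambda>_. 0)" by (simp add: representation_def)
  from representation_increment[OF this assms] show ?thesis
    by (auto intro: representation_imp_mem)
qed

lemma semigroup_gen_add_generator:
  "x \<in> semigroup_gen s t \<Longrightarrow> i \<in> {1..t} \<Longrightarrow> x + s i \<in> semigroup_gen s t"
  by (simp add: semigroup_gen_add semigroup_gen_generator)

lemma min_cost_le:
  assumes "representation s t k a"
  shows "min_cost s t k \<le> cost t a"
  unfolding min_cost_def by (rule Least_le) (use assms in auto)

lemma min_cost_attained:
  assumes "k \<in> semigroup_gen s t"
  obtains a where "representation s t k a" "cost t a = min_cost s t k"
proof -
  have "\<exists>a. representation s t k a \<and> cost t a = min_cost s t k"
    unfolding min_cost_def
    by (rule LeastI_ex) (use assms in \<open>auto simp: semigroup_gen_iff\<close>)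
  then show thesis using that by blast
qed

lemma min_cost_increment:
  assumes "x \<in> semigroup_gen s t" "i \<in> {1..t}"
  shows "min_cost s t (x + s i) \<le> Suc (min_cost s t x)"
proof -
  obtain a where "representation s t x a" "cost t a = min_cost s t x"
    by (rule min_cost_attained[OF assms(1)])
  then show ?thesis
    using min_cost_le[OF representation_increment] cost_increment assms(2) by metis
qed

section \<open>The greedy procedure, one copy at a time\<close>

text \<open>Apart from 0, the admissible quotients for \<open>x + d\<close> are the successors of
  those for \<open>x\<close>. The latter include 0 and are bounded by \<open>x\<close>, so their
  maximum exists.\<close>

lemma Greatest_quotient_add:
  fixes d x :: nat
  assumes "0 < d" "x \<in> G" "x + d \<in> G"
  shows "(GREATEST q. q * d \<le> x + d \<and> x + d - q * d \<in> G)
    = Suc (GREATEST q. q * d \<le> x \<and> x - q * d \<in> G)"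
proof (rule Greatest_equality)
  let ?P = "\<lambda>q. q * d \<le> x \<and> x - q * d \<in> G"
  have bound: "q \<le> x" if "?P q" for q
  proof -
    have "q \<le> q * d" using assms(1) by simp
    then show ?thesis using that by linarith
  qed
  have "?P (Greatest ?P)"
    by (rule GreatestI_nat[of ?P 0, OF _ bound]) (use assms in auto)
  then show "Suc (Greatest ?P) * d \<le> x + d \<and> x + d - Suc (Greatest ?P) * d \<in> G"
    by simp
  fix q assume q: "q * d \<le> x + d \<and> x + d - q * d \<in> G"
  show "q \<le> Suc (Greatest ?P)"
  proof (cases q)
    case (Suc p)
    then have "?P p" using q by simp
    then have "p \<le> Greatest ?P" by (rule Greatest_le_nat[OF _ bound])
    then show ?thesis using Suc by simp
  qed simp
qed

lemma greedy_from_above: "i < l \<Longrightarrow> greedy_from s G i r l = 0"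
  by (induction i arbitrary: r) (auto simp: Let_def)

lemma greedy_from_skip:
  assumes "r \<in> G" "\<And>l y. l \<in> {j<..i} \<Longrightarrow> y \<in> G \<Longrightarrow> y + s l \<noteq> r"
    "\<And>x l. x \<in> G \<Longrightarrow> l \<in> {j<..i} \<Longrightarrow> x + s l \<in> G" "j \<le> i"
  shows "greedy_from s G i r = greedy_from s G j r"
  using assms(4,2,3)
proof (induction i rule: dec_induct)
  case (step i)
  have mult: "y + n * s (Suc i) \<in> G" if "y \<in> G" for y n
  proof (induction n)
    case (Suc n)
    then show ?case using step.prems(2)[of "y + n * s (Suc i)" "Suc i"] step.hyps
      by (simp add: algebra_simps)
  qed (use that in simp)
  have "(GREATEST q. q * s (Suc i) \<le> r \<and> r - q * s (Suc i) \<in> G) = 0"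
  proof (rule Greatest_equality)
    fix q assume q: "q * s (Suc i) \<le> r \<and> r - q * s (Suc i) \<in> G"
    show "q \<le> 0"
    proof (cases q)
      case (Suc p)
      \<comment> \<open>Putting back all but one of the \<open>q\<close> copies writes
        \<open>r\<close> as an element of \<open>G\<close> plus one \<open>s (Suc i)\<close>, which
        is excluded.\<close>
      have "r - q * s (Suc i) + p * s (Suc i) \<in> G" by (rule mult) (use q in simp)
      then show ?thesis
        using step.prems(1)[of "Suc i" "r - q * s (Suc i) + p * s (Suc i)"] step.hyps q Suc
        by simp
    qed simp
  qed (use assms(1) in auto)
  then have "greedy_from s G (Suc i) r = greedy_from s G i r"
    by (auto simp: greedy_from_above)
  also have "\<dots> = greedy_from s G j r"
    by (rule step.IH) (use step.prems in auto)
  finally show ?case .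
qed simp

text \<open>Both runs skip every index above \<open>j\<close>: a larger generator in
  \<open>x\<close> would also occur in \<open>x + s j\<close>. At \<open>j\<close> the quotients
  differ by one, so both runs continue with the same remainder.\<close>

lemma greedy_rep_increment:
  assumes "x \<in> semigroup_gen s t" "j \<in> {1..t}" "0 < s j"
    and top: "\<And>l y. l \<in> {j<..t} \<Longrightarrow> y \<in> semigroup_gen s t \<Longrightarrow> y + s l \<noteq> x + s j"
  shows "greedy_rep s t (x + s j) = (greedy_rep s t x)(j := Suc (greedy_rep s t x j))"
proof -
  let ?G = "semigroup_gen s t"
  have top_x: "y + s l \<noteq> x" if "l \<in> {j<..t}" "y \<in> ?G" for l y
    using top[OF that(1) semigroup_gen_add_generator[OF that(2) assms(2)]] by auto
  have closed: "z + s l \<in> ?G" if "z \<in> ?G" "l \<in> {j<..t}" for z l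
    using that by (intro semigroup_gen_add_generator) auto
  have mem: "x + s j \<in> ?G" by (rule semigroup_gen_add_generator[OF assms(1,2)])
  have "greedy_rep s t (x + s j) = greedy_from s ?G j (x + s j)"
    unfolding greedy_rep_def by (rule greedy_from_skip) (use top closed mem assms(2) in auto)
  moreover have "greedy_rep s t x = greedy_from s ?G j x"
    unfolding greedy_rep_def by (rule greedy_from_skip) (use top_x closed assms in auto)
  moreover obtain i where "j = Suc i" using assms(2) by (cases j) auto
  ultimately show ?thesis
    using Greatest_quotient_add[OF assms(3,1) mem] by (simp add: Let_def)
qed

section \<open>Greedy cost by removing the largest usable generator\<close>

locale generating_sequence =
  fixes s :: "nat \<Rightarrow> nat" and t :: nat
  assumes generators: "generators s t"
begin

abbreviation G :: "nat set" where "G \<equiv> semigroup_gen s t"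

text \<open>Isolates one copy of the first generator that the greedy procedure uses, so that greedy
  costs obey a recursion on \<open>k\<close> instead of one on indices with whole quotients.\<close>

definition top_summand :: "nat \<Rightarrow> nat \<Rightarrow> nat \<Rightarrow> bool" where
  "top_summand k j x \<longleftrightarrow> k = x + s j \<and> x \<in> G \<and> j \<in> {1..t} \<and>
     (\<forall>l \<in> {j<..t}. \<forall>y \<in> G. y + s l \<noteq> k)"

lemma t_ge_3: "3 \<le> t"
  and s1_gt_1: "1 < s 1"
  and Gcd_generators: "Gcd (s ` {1..t}) = 1"
  using generators by (auto simp: generators_def)

lemma s_less: "1 \<le> i \<Longrightarrow> i < j \<Longrightarrow> j \<le> t \<Longrightarrow> s i < s j"
  using generators by (auto simp: generators_def strict_mono_on_def)

lemma s_le: "1 \<le> i \<Longrightarrow> i \<le> j \<Longrightarrow> j \<le> t \<Longrightarrow> s i \<le> s j"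
  using s_less[of i j] by (cases "i = j") auto

lemma s_pos: "i \<in> {1..t} \<Longrightarrow> 0 < s i"
  using s_le[of 1 i] s1_gt_1 by auto

lemma top_summand_exists:
  assumes "k \<in> G" "0 < k"
  obtains j x where "top_summand k j x"
proof -
  let ?J = "{j \<in> {1..t}. \<exists>x \<in> G. k = x + s j}"
  obtain a where a: "representation s t k a" using assms(1) by (auto simp: semigroup_gen_iff)
  obtain i where i: "i \<in> {1..t}" "0 < a i" using representation_support[OF a assms(2)] .
  obtain y b where "k = y + s i" "representation s t y b"
    using representation_decrement[OF a i] .
  then have "i \<in> ?J" using i(1) by (auto intro: representation_imp_mem)
  moreover have fin: "finite ?J" by simp
  ultimately have "Max ?J \<in> ?J" by (intro Max_in) auto
  then obtain x where "x \<in> G" "k = x + s (Max ?J)" "Max ?J \<in> {1..t}" by blast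
  moreover have "y + s l \<noteq> k" if "l \<in> {Max ?J<..t}" "y \<in> G" for l y
  proof
    assume "y + s l = k"
    then have "l \<in> ?J" using that by auto
    then have "l \<le> Max ?J" by (rule Max_ge[OF fin])
    then show False using that(1) by simp
  qed
  ultimately show thesis using that[of "Max ?J" x] by (auto simp: top_summand_def)
qed

lemma greedy_rep_top_summand:
  "top_summand k j x \<Longrightarrow> greedy_rep s t k = (greedy_rep s t x)(j := Suc (greedy_rep s t x j))"
  using greedy_rep_increment[of x s t j] s_pos by (auto simp: top_summand_def)

lemma greedy_cost_top_summand:
  assumes "top_summand k j x"
  shows "greedy_cost s t k = Suc (greedy_cost s t x)"
proof -
  have "j \<in> {1..t}" using assms by (simp add: top_summand_def)
  then show ?thesis
    unfolding greedy_cost_def greedy_rep_top_summand[OF assms] by (rule cost_increment)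
qed

lemma greedy_from_0: "i \<le> t \<Longrightarrow> greedy_from s G i 0 = (\<lambda>_. 0)"
proof (induction i)
  case (Suc i)
  have "(GREATEST q. q * s (Suc i) \<le> 0 \<and> 0 - q * s (Suc i) \<in> G) = 0"
    by (rule Greatest_equality) (use s_pos[of "Suc i"] Suc.prems in auto)
  then show ?case using Suc by simp
qed simp

lemma representation_greedy_rep: "k \<in> G \<Longrightarrow> representation s t k (greedy_rep s t k)"
proof (induction k rule: less_induct)
  case (less k)
  show ?case
  proof (cases "k = 0")
    case True
    then show ?thesis by (simp add: greedy_rep_def greedy_from_0 representation_def)
  next
    case False
    then obtain j x where top: "top_summand k j x"
      using top_summand_exists less.prems by auto
    then have x: "k = x + s j" "x \<in> G" "j \<in> {1..t}" by (auto simp: top_summand_def)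
    then have "representation s t x (greedy_rep s t x)"
      using less.IH s_pos[of j] by simp
    then show ?thesis
      using representation_increment x greedy_rep_top_summand[OF top] by metis
  qed
qed

lemma min_cost_le_greedy_cost: "k \<in> G \<Longrightarrow> min_cost s t k \<le> greedy_cost s t k"
  unfolding greedy_cost_def by (intro min_cost_le representation_greedy_rep)

text \<open>Every generator is at least \<open>s 1\<close>. Applied to greedy representations, this
  turns lower bounds on cost into lower bounds on value.\<close>

lemma cost_mult_le:
  assumes "representation s t k a"
  shows "cost t a * s 1 \<le> k"
  using assms unfolding cost_def representation_def sum_distrib_right
  by (auto intro!: sum_mono mult_le_mono s_le)

section \<open>Structure of the least counterexample and the lower bound\<close>

text \<open>Common starting point of both bounds and of the exact computation for
  \<open>{2, 5, 7}\<close>.\<close>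

lemma least_counterexample:
  assumes k: "k \<in> counterexamples s t"
    and least: "\<And>y. y < k \<Longrightarrow> y \<notin> counterexamples s t"
  obtains j x a where "top_summand k j x" "3 \<le> j" "representation s t k a"
    "cost t a = min_cost s t k" "\<And>i. i \<in> {j..t} \<Longrightarrow> a i = 0"
proof -
  have kG: "k \<in> G" and less: "min_cost s t k < greedy_cost s t k"
    using k by (auto simp: counterexamples_def)
  have "k \<noteq> 0"
  proof
    assume "k = 0"
    then have "greedy_cost s t k = 0"
      by (simp add: greedy_cost_def greedy_rep_def greedy_from_0 cost_def)
    then show False using less by simp
  qed
  then obtain j x where top: "top_summand k j x" using top_summand_exists kG by auto
  then have x: "k = x + s j" "x \<in> G" "j \<in> {1..t}" by (auto simp: top_summand_def)
  obtain a where a: "representation s t k a" "cost t a = min_cost s t k"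
    by (rule min_cost_attained[OF kG])
  have zero: "a i = 0" if i: "i \<in> {j..t}" for i
  proof (rule ccontr)
    assume "a i \<noteq> 0"
    moreover have it: "i \<in> {1..t}" using i x(3) by simp
    ultimately obtain y b where y: "k = y + s i" "representation s t y b"
        "cost t a = Suc (cost t b)"
      using representation_decrement[OF a(1), of i] by auto
    have yG: "y \<in> G" using y(2) by (rule representation_imp_mem)
    then have "\<not> j < i" using top y(1) i by (force simp: top_summand_def)
    then have "i = j" using i by simp
    then have "y = x" using y(1) x(1) by simp
    \<comment> \<open>Removing \<open>s j\<close> lowers the greedy cost by exactly one and the
      optimal cost by at least one, so the gap survives.\<close>
    then have "min_cost s t x < greedy_cost s t x"
      using min_cost_le[OF y(2)] y(3) a(2) less greedy_cost_top_summand[OF top] by simp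
    then have "x \<in> counterexamples s t" using x(2) by (simp add: counterexamples_def)
    then show False using least[of x] x(1) s_pos[OF x(3)] by simp
  qed
  have "3 \<le> j"
  proof (rule ccontr)
    assume "\<not> 3 \<le> j"
    then have "a i = 0" if "i \<in> {1..t} - {1}" for i using that zero[of i] by auto
    then have "(\<Sum>i \<in> {1..t} - {1}. a i * s i) = 0" "(\<Sum>i \<in> {1..t} - {1}. a i) = 0" by simp_all
    moreover have "(\<Sum>i = 1..t. f i) = f 1 + (\<Sum>i \<in> {1..t} - {1}. f i)" for f :: "nat \<Rightarrow> nat"
      using t_ge_3 by (intro sum.remove) auto
    ultimately have "k = a 1 * s 1" "cost t a = a 1"
      using a(1) by (simp_all only: representation_def cost_def add_0_right)
    then have "greedy_cost s t k * s 1 \<le> min_cost s t k * s 1"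
      using cost_mult_le[OF representation_greedy_rep[OF kG]] a(2) by (simp add: greedy_cost_def)
    then show False using less s1_gt_1 by simp
  qed
  then show thesis using that top a zero by blast
qed

lemma least_counterexample_ge:
  assumes "k \<in> counterexamples s t" "\<And>y. y < k \<Longrightarrow> y \<notin> counterexamples s t"
  shows "s 3 + s 1 + 2 \<le> k"
proof -
  obtain j x a where top: "top_summand k j x" and j: "3 \<le> j"
      and a: "representation s t k a" "cost t a = min_cost s t k"
      and zero: "\<And>i. i \<in> {j..t} \<Longrightarrow> a i = 0"
    using least_counterexample[OF assms] by metis
  have x: "k = x + s j" "x \<in> G" "j \<in> {1..t}" using top by (auto simp: top_summand_def)
  have "2 \<le> cost t a"
  proof (rule ccontr)
    assume "\<not> 2 \<le> cost t a"
    \<comment> \<open>Below \<open>j\<close> the generators are at most \<open>s j\<close>, and from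
      \<open>j\<close> on the coefficients vanish. Hence a cost of at most 1 would give
      \<open>k \<le> s j\<close>, leaving \<open>x = 0\<close>.\<close>
    have "a i * s i \<le> a i * s j" if "i \<in> {1..t}" for i
      using zero[of i] s_le[of i j] that x(3) by (cases "i \<le> j") auto
    then have "(\<Sum>i = 1..t. a i * s i) \<le> (\<Sum>i = 1..t. a i * s j)" by (rule sum_mono)
    then have "k \<le> cost t a * s j"
      using a(1) by (simp add: representation_def cost_def sum_distrib_right)
    also have "\<dots> \<le> 1 * s j" using \<open>\<not> 2 \<le> cost t a\<close> by (intro mult_le_mono) auto
    finally have "x = 0" using x(1) by simp
    then have "greedy_cost s t k = 1"
      using greedy_cost_top_summand[OF top]
      by (simp add: greedy_cost_def greedy_rep_def greedy_from_0 cost_def)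
    then have "cost t a = 0" using assms(1) a(2) by (simp add: counterexamples_def)
    then have "k = 0" using a(1) by (simp add: cost_def representation_def)
    then show False using x(1) s_pos[OF x(3)] by simp
  qed
  then have "2 \<le> greedy_cost s t x"
    using assms(1) a(2) greedy_cost_top_summand[OF top] by (simp add: counterexamples_def)
  then have "2 * s 1 \<le> greedy_cost s t x * s 1" by (intro mult_le_mono) auto
  also have "\<dots> \<le> x"
    unfolding greedy_cost_def by (rule cost_mult_le[OF representation_greedy_rep[OF x(2)]])
  finally have "2 * s 1 \<le> x" .
  \<comment> \<open>One of the two copies of \<open>s 1\<close> is weakened to 2.\<close>
  then show ?thesis using x(1) s_le[of 3 j] j x(3) s1_gt_1 by simp
qed

section \<open>Cofiniteness and the Frobenius number\<close>

lemma semigroup_gen_cofinite: "\<exists>N. \<forall>n \<ge> N. n \<in> G"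
proof -
  \<comment> \<open>The set of differences of semigroup elements is closed under subtraction, so its
    least positive element divides all of it, in particular every generator. As the gcd is 1, two
    consecutive integers lie in \<open>G\<close>.\<close>
  define D where "D = {d. \<exists>x \<in> G. x + d \<in> G}"
  have gen: "s i \<in> D" if "i \<in> {1..t}" for i
    unfolding D_def using semigroup_gen_0 semigroup_gen_generator[of i t s] that
    by (force intro!: bexI[of _ 0])
  have diff: "m - n \<in> D" if mn: "m \<in> D" "n \<in> D" "n \<le> m" for m n
  proof -
    obtain x y where xy: "x \<in> G" "x + m \<in> G" "y \<in> G" "y + n \<in> G" using mn by (auto simp: D_def)
    have "x + (y + n) + (m - n) = (x + m) + y" using mn(3) by simp
    then have "x + (y + n) + (m - n) \<in> G" using semigroup_gen_add[OF xy(2,3)] by (simp add: ac_simps)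
    then show ?thesis unfolding D_def using semigroup_gen_add[OF xy(1,4)] by blast
  qed
  define d where "d = (LEAST d. 0 < d \<and> d \<in> D)"
  have "0 < s 1 \<and> s 1 \<in> D" using gen[of 1] s1_gt_1 t_ge_3 by simp
  then have d: "0 < d \<and> d \<in> D" unfolding d_def by (rule LeastI)
  have dvd: "d dvd m" if "m \<in> D" for m
    using that
  proof (induction m rule: less_induct)
    case (less m)
    show ?case
    proof (cases "m < d")
      case True
      then have "m = 0" using less.prems not_less_Least[of m "\<lambda>d. 0 < d \<and> d \<in> D"]
        by (simp flip: d_def)
      then show ?thesis by simp
    next
      case False
      then have "d dvd m - d" using less.IH[of "m - d"] diff less.prems d by simp
      then show ?thesis using False by (simp add: dvd_diff_nat dvd_minus_self)
    qed
  qed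
  have "d dvd Gcd (s ` {1..t})" by (rule Gcd_greatest) (use gen dvd in auto)
  then have "1 \<in> D" using d unfolding Gcd_generators by simp
  then obtain x where x: "x \<in> G" "x + 1 \<in> G" by (auto simp: D_def)
  have "n \<in> G" if n: "x * x \<le> n" for n
  proof (cases "x = 0")
    case True
    then show ?thesis using semigroup_gen_mult[OF x(2), of n] by simp
  next
    case False
    define q r where "q = n div x" and "r = n mod x"
    \<comment> \<open>Since \<open>r < x \<le> q\<close>, the remainder can be absorbed by replacing
      \<open>r\<close> of the \<open>q\<close> copies of \<open>x\<close> by
      \<open>x + 1\<close>.\<close>
    have "x \<le> q" using div_le_mono[OF n, of x] False by (simp add: q_def)
    moreover have "r < x" unfolding r_def using False by simp
    ultimately obtain p where p: "q = p + r" by (metis le_add_diff_inverse2 less_or_eq_imp_le le_trans)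
    have "n = q * x + r" by (simp add: q_def r_def)
    also have "\<dots> = p * x + r * (x + 1)" by (simp add: p algebra_simps)
    finally show ?thesis using semigroup_gen_add semigroup_gen_mult x by metis
  qed
  then show ?thesis by blast
qed

text \<open>A missing \<open>k\<close> makes the finite set of gaps nonempty, so its maximum is the
  value of \<open>GREATEST\<close> and is at least \<open>k\<close>. Negative integers are also
  outside the image but lie below this maximum.\<close>

lemma above_frobenius:
  assumes "frobenius G < int k"
  shows "k \<in> G"
proof (rule ccontr)
  assume "k \<notin> G"
  obtain N where N: "\<And>n. N \<le> n \<Longrightarrow> n \<in> G" using semigroup_gen_cofinite by blast
  define M where "M = {n. n \<notin> G}"
  have fin: "finite M" unfolding M_def
    by (rule finite_subset[of _ "{..<N}"]) (use N in \<open>auto simp: not_less[symmetric]\<close>)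
  have "k \<in> M" using \<open>k \<notin> G\<close> by (simp add: M_def)
  then have max: "Max M \<in> M" "k \<le> Max M" using fin by (auto intro: Max_in)
  have "frobenius G = int (Max M)" unfolding frobenius_def
  proof (rule Greatest_equality)
    show "int (Max M) \<notin> int ` G" using max(1) by (auto simp: M_def)
    fix z assume z: "z \<notin> int ` G"
    show "z \<le> int (Max M)"
    proof (cases "0 \<le> z")
      case True
      then have "nat z \<in> M" using z by (force simp: M_def image_iff)
      then have "nat z \<le> Max M" using fin by simp
      then show ?thesis using True by linarith
    qed simp
  qed
  then show False using assms max(2) by simp
qed

section \<open>The upper bound\<close>

text \<open>With \<open>z = k - s t - s i\<close>, \<open>x = z + s i\<close> and
  \<open>y = z + s t\<close>, minimality of \<open>k\<close> makes greedy optimal at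
  \<open>x\<close> and \<open>y\<close>. Both have cost at most, respectively exactly, one more than
  the greedy cost of \<open>z\<close>, so greedy is no worse than \<open>a\<close> at
  \<open>k\<close>.\<close>

lemma least_counterexample_le:
  assumes k: "k \<in> counterexamples s t"
    and least: "\<And>y. y < k \<Longrightarrow> y \<notin> counterexamples s t"
  shows "int k \<le> frobenius G + int (s t) + int (s (t - 1))"
proof (rule ccontr)
  assume "\<not> ?thesis"
  then have large: "frobenius G < int k - int (s t) - int (s (t - 1))" by simp
  have kG: "k \<in> G" and less: "min_cost s t k < greedy_cost s t k"
    using k by (auto simp: counterexamples_def)
  obtain j x a where top: "top_summand k j x"
      and a: "representation s t k a" "cost t a = min_cost s t k"
      and zero: "\<And>i. i \<in> {j..t} \<Longrightarrow> a i = 0"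
    using least_counterexample[OF assms] by metis
  have x: "k = x + s j" "j \<in> {1..t}" using top by (auto simp: top_summand_def)
  have "0 < k" using s_pos[OF x(2)] x(1) by simp
  obtain i where i: "i \<in> {1..t}" "0 < a i" using representation_support[OF a(1) \<open>0 < k\<close>] .
  obtain y b where y: "k = y + s i" "representation s t y b" "cost t a = Suc (cost t b)"
    using representation_decrement[OF a(1) i] .
  have yG: "y \<in> G" using y(2) by (rule representation_imp_mem)
  have "i < j" using zero[of i] i by force
  then have i_le: "s i \<le> s (t - 1)" using s_le[of i "t - 1"] i(1) x(2) by simp
  \<comment> \<open>Yields a positive Frobenius number, so \<open>k\<close> exceeds
    \<open>s t + s i\<close> and the natural subtraction defining \<open>z\<close> is exact.\<close>
  have "1 \<notin> G"
  proof
    assume "1 \<in> G"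
    then obtain c where c: "representation s t 1 c" by (auto simp: semigroup_gen_iff)
    then have "cost t c = 0" using cost_mult_le[OF c] s1_gt_1 by (cases "cost t c") auto
    then show False using c by (simp add: cost_def representation_def)
  qed
  then have "1 \<le> frobenius G" using above_frobenius[of 1] by force
  then obtain z where z: "k = z + s t + s i"
    using large i_le that[of "k - s t - s i"] by linarith
  have "z \<in> G" by (rule above_frobenius) (use large i_le z in linarith)
  have t: "t \<in> {1..t}" using t_ge_3 by simp
  have "z + s i \<in> G" using \<open>z \<in> G\<close> i(1) by (rule semigroup_gen_add_generator)
  have "j = t"
  proof (rule ccontr)
    assume "j \<noteq> t"
    then have "t \<in> {j<..t}" using x(2) by simp
    then have "z + s i + s t \<noteq> k" using top \<open>z + s i \<in> G\<close> unfolding top_summand_def by blast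
    then show False using z by simp
  qed
  then have x_eq: "x = z + s i" using x(1) z by simp
  have y_eq: "y = z + s t" using y(1) z by simp
  have not_ce: "greedy_cost s t w \<le> min_cost s t w" if "w < k" "w \<in> G" for w
    using least[OF that(1)] that(2) by (simp add: counterexamples_def)
  have "greedy_cost s t x \<le> min_cost s t x"
    by (rule not_ce) (use x(1) s_pos[OF x(2)] x_eq \<open>z + s i \<in> G\<close> in auto)
  also have "\<dots> \<le> Suc (min_cost s t z)"
    unfolding x_eq using \<open>z \<in> G\<close> i(1) by (rule min_cost_increment)
  also have "\<dots> \<le> Suc (greedy_cost s t z)"
    using min_cost_le_greedy_cost[OF \<open>z \<in> G\<close>] by simp
  also have "\<dots> = greedy_cost s t y"
    using greedy_cost_top_summand[of y t z] y_eq \<open>z \<in> G\<close> t by (simp add: top_summand_def)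
  also have "\<dots> \<le> min_cost s t y"
    by (rule not_ce) (use y(1) s_pos[OF i(1)] yG in auto)
  also have "\<dots> \<le> cost t b" by (rule min_cost_le[OF y(2)])
  finally have "greedy_cost s t k \<le> cost t a"
    using greedy_cost_top_summand[OF top] y(3) by simp
  then show False using less a(2) by simp
qed

lemma Least_counterexample:
  assumes "counterexamples s t \<noteq> {}"
  defines "k \<equiv> (LEAST k. k \<in> counterexamples s t)"
  shows "k \<in> counterexamples s t" "\<And>y. y < k \<Longrightarrow> y \<notin> counterexamples s t"
  unfolding k_def using assms(1) by (auto intro: LeastI dest: not_less_Least)

end

section \<open>Sharpness: examples with three generators\<close>

lemma atLeastAtMost_1_3: "{1..3::nat} = {1, 2, 3}"
  by auto

text \<open>Serves both as a generating sequence and as a coefficient vector.\<close>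

definition triple :: "nat \<Rightarrow> nat \<Rightarrow> nat \<Rightarrow> nat \<Rightarrow> nat" where
  "triple x y z = (\<lambda>_. 0)(1 := x, 2 := y, 3 := z)"

lemma triple_simps [simp]:
  "triple x y z 1 = x" "triple x y z (Suc 0) = x" "triple x y z 2 = y" "triple x y z 3 = z"
  by (simp_all add: triple_def)

lemma generators_triple:
  assumes "1 < x" "x < y" "y < z" "coprime x y"
  shows "generators (triple x y z) 3"
  using assms unfolding generators_def strict_mono_on_def atLeastAtMost_1_3
  by (auto simp: coprime_iff_gcd_eq_1 simp flip: gcd.assoc)

lemma representation_3: "representation s 3 k a \<longleftrightarrow> a 1 * s 1 + a 2 * s 2 + a 3 * s 3 = k"
  unfolding representation_def atLeastAtMost_1_3 by (simp add: add.assoc)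

lemma cost_3: "cost 3 a = a 1 + a 2 + a 3"
  unfolding cost_def atLeastAtMost_1_3 by simp

text \<open>Replaces evaluation of the greedy procedure in the examples: linear arithmetic on a
  representation that contains \<open>s t\<close> suffices.\<close>

lemma (in generating_sequence) top_generator:
  assumes "x \<in> G"
  obtains g where "representation s t (x + s t) g" "0 < g t"
    "greedy_cost s t (x + s t) = cost t g"
proof -
  have top: "top_summand (x + s t) t x"
    using assms t_ge_3 by (simp add: top_summand_def)
  have "x + s t \<in> G" using assms t_ge_3 by (intro semigroup_gen_add_generator) auto
  then show thesis
    using that representation_greedy_rep greedy_rep_top_summand[OF top]
    by (metis fun_upd_same greedy_cost_def zero_less_Suc)
qed

text \<open>Greedy is forced to 6 + 2 + 2, against 5 + 5.\<close>

lemma counterexample_2_5_6: "10 \<in> counterexamples (triple 2 5 6) 3"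
proof -
  let ?s = "triple 2 5 6"
  interpret generating_sequence ?s 3 by standard (simp add: generators_triple)
  have "representation ?s 3 4 (triple 2 0 0)" by (simp add: representation_3)
  then have "4 \<in> G" by (rule representation_imp_mem)
  then obtain g where g: "representation ?s 3 10 g" "0 < g 3" "greedy_cost ?s 3 10 = cost 3 g"
    using top_generator[OF \<open>4 \<in> G\<close>] by auto
  have eq: "g 1 * 2 + g 2 * 5 + g 3 * 6 = 10"
    using g(1) unfolding representation_3 triple_simps .
  then have "g 3 = 1" "g 2 = 0" using g(2) by linarith+
  with eq have "3 \<le> cost 3 g" unfolding cost_3 by linarith
  moreover have "representation ?s 3 10 (triple 0 2 0)" by (simp add: representation_3)
  then have "min_cost ?s 3 10 \<le> 2" using min_cost_le by (fastforce simp: cost_3)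
  ultimately show ?thesis
    using representation_imp_mem[OF g(1)] g(3) by (simp add: counterexamples_def)
qed

text \<open>Greedy is forced to 7 + 2 + 2 + 2 + 2, against 5 + 5 + 5.\<close>

lemma counterexample_2_5_7: "15 \<in> counterexamples (triple 2 5 7) 3"
proof -
  let ?s = "triple 2 5 7"
  interpret generating_sequence ?s 3 by standard (simp add: generators_triple)
  have "representation ?s 3 8 (triple 4 0 0)" by (simp add: representation_3)
  then have "8 \<in> G" by (rule representation_imp_mem)
  then obtain g where g: "representation ?s 3 15 g" "0 < g 3" "greedy_cost ?s 3 15 = cost 3 g"
    using top_generator[OF \<open>8 \<in> G\<close>] by auto
  have eq: "g 1 * 2 + g 2 * 5 + g 3 * 7 = 15"
    using g(1) unfolding representation_3 triple_simps .
  then have "g 3 = 1 \<or> g 3 = 2" "g 2 = 0 \<or> g 2 = 1" using g(2) by linarith+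
  with eq have "g 3 = 1" "g 2 = 0" by (elim disjE; simp; presburger)+
  with eq have "4 \<le> cost 3 g" unfolding cost_3 by linarith
  moreover have "representation ?s 3 15 (triple 0 3 0)" by (simp add: representation_3)
  then have "min_cost ?s 3 15 \<le> 3" using min_cost_le by (fastforce simp: cost_3)
  ultimately show ?thesis
    using representation_imp_mem[OF g(1)] g(3) by (simp add: counterexamples_def)
qed

lemma frobenius_2_5_7: "frobenius (semigroup_gen (triple 2 5 7) 3) = 3"
  unfolding frobenius_def
proof (rule Greatest_equality)
  show "(3::int) \<notin> int ` semigroup_gen (triple 2 5 7) 3"
  proof
    assume "(3::int) \<in> int ` semigroup_gen (triple 2 5 7) 3"
    then obtain a where "representation (triple 2 5 7) 3 3 a" by (force simp: semigroup_gen_iff)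
    then have eq: "a 1 * 2 + a 2 * 5 + a 3 * 7 = 3" unfolding representation_3 triple_simps .
    then have "a 2 = 0" "a 3 = 0" by linarith+
    with eq have "even (3 :: nat)" by (metis add_0_right dvd_triv_right mult_zero_left)
    then show False by simp
  qed
  fix z :: int assume z: "z \<notin> int ` semigroup_gen (triple 2 5 7) 3"
  show "z \<le> 3"
  proof (rule ccontr)
    assume "\<not> z \<le> 3"
    then obtain n where n: "z = int n" "4 \<le> n" by (cases z) auto
    \<comment> \<open>Even numbers need only copies of 2; odd ones from 5 on need a single
      5.\<close>
    have "n = n div 2 * 2 + 0 * 5 \<or> n = (n - 5) div 2 * 2 + 1 * 5" using n(2) by presburger
    then obtain a b where ab: "z = int (a * 2 + b * 5)" using n(1) by metis
    have "representation (triple 2 5 7) 3 (a * 2 + b * 5) (triple a b 0)"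
      by (simp add: representation_3)
    then show False using z ab representation_imp_mem by blast
  qed
qed

text \<open>The general lower bound gives only 7 + 2 + 2 = 11 here, so minimality of 15 needs its
  own argument.\<close>

lemma least_counterexample_2_5_7:
  assumes "k \<in> counterexamples (triple 2 5 7) 3"
    and "\<And>y. y < k \<Longrightarrow> y \<notin> counterexamples (triple 2 5 7) 3"
  shows "15 \<le> k"
proof -
  let ?s = "triple 2 5 7"
  interpret generating_sequence ?s 3 by standard (simp add: generators_triple)
  obtain j x a where top: "top_summand k j x" "3 \<le> j" and a: "representation ?s 3 k a"
      "cost 3 a = min_cost ?s 3 k" "\<And>i. i \<in> {j..3} \<Longrightarrow> a i = 0"
    using least_counterexample[OF assms] by metis
  then have "j = 3" by (simp add: top_summand_def)
  with top a(3) have x: "k = x + ?s 3" "x \<in> G" and a3: "a 3 = 0"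
    by (simp_all add: top_summand_def)
  obtain g where g: "representation ?s 3 k g" "0 < g 3" "greedy_cost ?s 3 k = cost 3 g"
    using top_generator[OF x(2)] x(1) by auto
  have "cost 3 a < cost 3 g" using assms(1) a(2) g(3) by (simp add: counterexamples_def)
  \<comment> \<open>Subtracting twice the cost from each value gives
    \<open>3 * a 2 = 3 * g 2 + 5 * g 3 + 2 * (cost 3 g - cost 3 a)\<close>, which is at least
    7.\<close>
  then have "3 \<le> a 2"
    using a(1) a3 g(1,2) unfolding representation_3 cost_3 triple_simps by linarith
  then show ?thesis using a(1) unfolding representation_3 triple_simps by linarith
qed

theorem theorem1:
  shows "(\<forall>s t. generators s t \<and> counterexamples s t \<noteq> {} \<longrightarrow>
            s 3 + s 1 + 2 \<le> (LEAST k. k \<in> counterexamples s t) \<and>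
            int (LEAST k. k \<in> counterexamples s t)
              \<le> frobenius (semigroup_gen s t) + int (s t) + int (s (t - 1))) \<and>
         (\<exists>s t. generators s t \<and> counterexamples s t \<noteq> {} \<and>
            (LEAST k. k \<in> counterexamples s t) = s 3 + s 1 + 2) \<and>
         (\<exists>s t. generators s t \<and> counterexamples s t \<noteq> {} \<and>
            int (LEAST k. k \<in> counterexamples s t)
              = frobenius (semigroup_gen s t) + int (s t) + int (s (t - 1)))"
proof (intro conjI allI impI)
  fix s t assume st: "generators s t \<and> counterexamples s t \<noteq> {}"
  then interpret generating_sequence s t by unfold_locales simp
  show "s 3 + s 1 + 2 \<le> (LEAST k. k \<in> counterexamples s t)"
    using least_counterexample_ge Least_counterexample st by blast
  show "int (LEAST k. k \<in> counterexamples s t) \<le> frobenius G + int (s t) + int (s (t - 1))"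
    using least_counterexample_le Least_counterexample st by blast
next
  let ?s = "triple 2 5 6"
  have gen: "generators ?s 3" by (simp add: generators_triple)
  then interpret generating_sequence ?s 3 by unfold_locales
  have ne: "counterexamples ?s 3 \<noteq> {}" using counterexample_2_5_6 by blast
  have "10 \<le> (LEAST k. k \<in> counterexamples ?s 3)"
    using least_counterexample_ge[OF Least_counterexample[OF ne]] by simp
  moreover have "(LEAST k. k \<in> counterexamples ?s 3) \<le> 10"
    by (intro Least_le counterexample_2_5_6)
  ultimately show "\<exists>s t. generators s t \<and> counterexamples s t \<noteq> {} \<and>
      (LEAST k. k \<in> counterexamples s t) = s 3 + s 1 + 2"
    using gen ne by (intro exI[of _ ?s] exI[of _ 3]) simp
next
  let ?s = "triple 2 5 7"
  have gen: "generators ?s 3" by (simp add: generators_triple)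
  then interpret generating_sequence ?s 3 by unfold_locales
  have ne: "counterexamples ?s 3 \<noteq> {}" using counterexample_2_5_7 by blast
  \<comment> \<open>The target value is 3 + 7 + 5 = 15, with 3 the Frobenius number.\<close>
  have "15 \<le> (LEAST k. k \<in> counterexamples ?s 3)"
    using least_counterexample_2_5_7[OF Least_counterexample[OF ne]] .
  moreover have "(LEAST k. k \<in> counterexamples ?s 3) \<le> 15"
    by (intro Least_le counterexample_2_5_7)
  ultimately show "\<exists>s t. generators s t \<and> counterexamples s t \<noteq> {} \<and>
      int (LEAST k. k \<in> counterexamples s t)
        = frobenius (semigroup_gen s t) + int (s t) + int (s (t - 1))"
    using gen ne by (intro exI[of _ ?s] exI[of _ 3]) (simp add: frobenius_2_5_7)
qed

end
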